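(* Let $b=b(n)$ be positive integers with $b=o(\log n)$ as $n\to\infty$, let $\gamma>1.5$ be a constant, and let $\Phi_n$ be an $n\times n$ random matrix with iid entries having mean $0$ and variance $1/n$. Then the empirical spectral distribution of $T_{b,n}+n^{-\gamma}\Phi_n$ converges in probability, as $n\to\infty$, to the Dirac measure $\delta_0$ with mass $1$ at the origin.
   Context: $T_k$ denotes the $k\times k$ matrix with entries $1$ in positions $(i,i+1)$, $1\le i\le k-1$, and $0$ elsewhere. For a positive integer $b$, $T_{b,n}$ is the $n\times n$ block diagonal matrix with $\lfloor n/(b+1)\rfloor$ consecutive diagonal blocks equal to $T_{b+1}$, followed, if $k=n-\lfloor n/(b+1)\rfloor(b+1)>0$, by one last diagonal block equal to $T_k$. The empirical spectral distribution of an $n\times n$ complex matrix $A$ with eigenvalues $\lambda_1,\dots,\lambda_n$ (with multiplicity) is $\mu_A=\frac1n\sum_{j=1}^n\delta_{\lambda_j}$. $\mu_{A_n}$ converges in probability to a probability measure $\mu$ on $\mathbb C$ if for every smooth compactly supported $g:\mathbb C\to\mathbb C$, $\int g\,d\mu_{A_n}\to\int g\,d\mu$ in probability. Entries are complex-valued; the variance of a mean-zero complex random variable $x$ is $\mathbb E|x|^2$. *)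

theory Defs
  imports
    "HOL-Probability.Probability"
    "HOL-Library.Landau_Symbols"
    "Jordan_Normal_Form.Char_Poly"
begin

definition shift_mat :: "nat \<Rightarrow> complex mat" where
  "shift_mat k = mat k k (\<lambda>(i, j). if j = i + 1 then 1 else 0)"

definition block_shift_mat :: "nat \<Rightarrow> nat \<Rightarrow> complex mat" where
  "block_shift_mat b n =
     (let q = n div (b + 1); k = n - q * (b + 1)
      in diag_block_mat (replicate q (shift_mat (b + 1)) @ (if k > 0 then [shift_mat k] else [])))"

text \<open>
  The empirical spectral distribution. For an \<open>n \<times> n\<close> complex matrix with \<open>n > 0\<close>, the multiset
  of roots of the characteristic polynomial has exactly \<open>n\<close> elements (the eigenvalues with
  algebraic multiplicity), and \<^const>\<open>pmf_of_multiset\<close> gives every element of it the weight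
  \<open>1/n\<close>. For \<open>n = 0\<close> the value is unspecified.
\<close>
definition esd :: "complex mat \<Rightarrow> complex measure" where
  "esd A = distr (measure_pmf (pmf_of_multiset (proots (char_poly A)))) borel (\<lambda>z. z)"

text \<open>
  Differentiability is over the reals here (complex-valued functions on the real plane), and the
  derivatives of order \<open>k + 1\<close> are obtained as derivatives of order \<open>k\<close> of all directional
  derivatives.
\<close>
primrec k_times_cont_diff :: "nat \<Rightarrow> (complex \<Rightarrow> complex) \<Rightarrow> bool" where
  "k_times_cont_diff 0 g \<longleftrightarrow> continuous_on UNIV g"
| "k_times_cont_diff (Suc k) g \<longleftrightarrow>
     (\<forall>z. g differentiable (at z)) \<and>
     (\<forall>v. k_times_cont_diff k (\<lambda>z. frechet_derivative g (at z) v))"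

definition smooth :: "(complex \<Rightarrow> complex) \<Rightarrow> bool" where
  "smooth g \<longleftrightarrow> (\<forall>k. k_times_cont_diff k g)"

definition compactly_supported :: "(complex \<Rightarrow> complex) \<Rightarrow> bool" where
  "compactly_supported g \<longleftrightarrow> compact (closure {z. g z \<noteq> 0})"

text \<open>
  Every \<open>n\<close> may have its own probability space \<open>M n\<close>; this is meaningful because the limit is
  deterministic. The notion is intended for measurable \<open>X n\<close>, since \<^const>\<open>measure\<close> is \<open>0\<close> on
  non-measurable sets. Integrals of continuous functions with respect to the empirical spectral
  distribution of a matrix with measurable entries are measurable, because the multiset of
  eigenvalues depends continuously on the entries.
\<close>
definition tendsto_in_prob ::
    "(nat \<Rightarrow> 'w measure) \<Rightarrow> (nat \<Rightarrow> 'w \<Rightarrow> complex) \<Rightarrow> complex \<Rightarrow> bool" where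
  "tendsto_in_prob M X c \<longleftrightarrow>
     (\<forall>\<epsilon>>0. (\<lambda>n. measure (M n) {\<omega> \<in> space (M n). dist (X n \<omega>) c > \<epsilon>}) \<longlonglongrightarrow> 0)"

definition measures_tendsto_in_prob ::
    "(nat \<Rightarrow> 'w measure) \<Rightarrow> (nat \<Rightarrow> 'w \<Rightarrow> complex measure) \<Rightarrow> complex measure \<Rightarrow> bool" where
  "measures_tendsto_in_prob M \<nu> \<mu> \<longleftrightarrow>
     (\<forall>g. smooth g \<and> compactly_supported g \<longrightarrow>
        tendsto_in_prob M (\<lambda>n \<omega>. \<integral>z. g z \<partial>(\<nu> n \<omega>)) (\<integral>z. g z \<partial>\<mu>))"

text \<open>
  A random \<open>n \<times> n\<close> matrix with iid complex entries of mean \<open>0\<close> and variance \<open>v\<close>. Measurability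
  of the entries is part of \<^const>\<open>prob_space.indep_vars\<close>.
\<close>
definition iid_random_mat :: "'w measure \<Rightarrow> nat \<Rightarrow> real \<Rightarrow> ('w \<Rightarrow> complex mat) \<Rightarrow> bool" where
  "iid_random_mat M n v \<Phi> \<longleftrightarrow>
     (\<forall>\<omega>\<in>space M. \<Phi> \<omega> \<in> carrier_mat n n) \<and>
     prob_space.indep_vars M (\<lambda>_. borel) (\<lambda>(i, j) \<omega>. \<Phi> \<omega> $$ (i, j)) ({..<n} \<times> {..<n}) \<and>
     (\<forall>i<n. \<forall>j<n. \<forall>k<n. \<forall>l<n.
        distr M borel (\<lambda>\<omega>. \<Phi> \<omega> $$ (i, j)) = distr M borel (\<lambda>\<omega>. \<Phi> \<omega> $$ (k, l))) \<and>
     (\<forall>i<n. \<forall>j<n.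
        integrable M (\<lambda>\<omega>. \<Phi> \<omega> $$ (i, j)) \<and>
        (\<integral>\<omega>. \<Phi> \<omega> $$ (i, j) \<partial>M) = 0 \<and>
        integrable M (\<lambda>\<omega>. (cmod (\<Phi> \<omega> $$ (i, j)))\<^sup>2) \<and>
        (\<integral>\<omega>. (cmod (\<Phi> \<omega> $$ (i, j)))\<^sup>2 \<partial>M) = v)"

end

theory Submission
  imports Defs
begin

text \<open>
  Deterministic perturbation theory of a nilpotent matrix gives more than the statement: with
  probability tending to \<open>1\<close>, all eigenvalues of the perturbed matrix tend to \<open>0\<close>, uniformly.

  Let \<open>T\<close> be the block shift and \<open>E\<close> an arbitrary perturbation. If \<open>(T + E) v = l v\<close>, then
  \<open>l v\<^sub>i = (T v)\<^sub>i + (E v)\<^sub>i\<close>, where \<open>(T v)\<^sub>i\<close> is \<open>v\<^sub>i\<^sub>+\<^sub>1\<close>, or \<open>0\<close> at the end of a block. Solving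
  backwards from the end of each block takes at most \<open>b + 1\<close> steps. If \<open>\<bar>l\<bar> \<ge> \<eta>\<close> and \<open>\<eta> \<le> 1\<close>, each step costs at
  most a factor \<open>2 / \<eta>\<close>, so that \<open>\<parallel>v\<parallel>\<^sub>\<infinity> \<le> \<parallel>E v\<parallel>\<^sub>\<infinity> (2 / \<eta>)\<^sup>b\<^sup>+\<^sup>1\<close>. Hence an eigenvalue of modulus at least
  \<open>\<eta>\<close> forces the sum of the moduli of the entries of \<open>E\<close> to be at least \<open>(\<eta> / 2)\<^sup>b\<^sup>+\<^sup>1\<close>
  (\<open>eigenvalue_block_shift_perturbation\<close>), which decays more slowly than any power of \<open>1 / n\<close>
  because \<open>b\<close> is \<open>o(log n)\<close>.

  For the random perturbation, the \<open>n\<^sup>2\<close> entries of \<open>\<Phi>\<close> have first absolute moments at most \<open>n\<close> to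
  the power \<open>-1/2\<close>, so that the sum of the moduli of the entries of \<open>E\<close> has expectation at most \<open>n\<close> to
  the power \<open>3/2 - \<gamma>\<close>. This is where \<open>\<gamma> > 3/2\<close> enters. Markov's inequality
  (\<open>prob_entry_sum_ge\<close>) bounds the probability of an eigenvalue outside the disc of radius \<open>\<eta>\<close> by a
  quantity that tends to \<open>0\<close> (\<open>powr_mult_power_tendsto_0\<close>). When all eigenvalues lie in a small
  disc, continuity of the test function at \<open>0\<close> makes its average over them close to its value
  at \<open>0\<close> (\<open>dist_integral_esd_le\<close>).
\<close>

section \<open>The block shift matrix\<close>

text \<open>
  The boundary of every block lies at a multiple of \<open>b + 1\<close>, so a single congruence condition
  describes where the superdiagonal is interrupted. The last block is shorter than \<open>b + 1\<close> and
  contains no such boundary in its interior.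
\<close>
lemma diag_block_shift_entries:
  fixes b k q :: nat
  assumes "k \<le> b"
  defines "D \<equiv> diag_block_mat (replicate q (shift_mat (b + 1)) @ (if k > 0 then [shift_mat k] else []))"
  shows "D \<in> carrier_mat (q * (b + 1) + k) (q * (b + 1) + k) \<and>
    (\<forall>i < q * (b + 1) + k. \<forall>j < q * (b + 1) + k.
       D $$ (i, j) = (if j = Suc i \<and> Suc i mod (b + 1) \<noteq> 0 then 1 else 0))"
  unfolding D_def
proof (induction q)
  case 0
  show ?case
    using assms(1) by (auto simp: shift_mat_def)
next
  case (Suc q)
  define B where "B = diag_block_mat (replicate q (shift_mat (b + 1)) @ (if k > 0 then [shift_mat k] else []))"
  define N where "N = q * (b + 1) + k"
  define S where "S = shift_mat (b + 1)"
  have dB: "dim_row B = N" "dim_col B = N"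
    and entB: "\<And>i j. i < N \<Longrightarrow> j < N \<Longrightarrow>
      B $$ (i, j) = (if j = Suc i \<and> Suc i mod (b + 1) \<noteq> 0 then 1 else 0)"
    using Suc.IH unfolding B_def N_def by auto
  have dS: "dim_row S = b + 1" "dim_col S = b + 1"
    and entS: "\<And>i j. i < b + 1 \<Longrightarrow> j < b + 1 \<Longrightarrow> S $$ (i, j) = (if j = Suc i then 1 else 0)"
    unfolding S_def shift_mat_def by auto
  have eq: "diag_block_mat (replicate (Suc q) (shift_mat (b + 1)) @ (if k > 0 then [shift_mat k] else []))
      = four_block_mat S (0\<^sub>m (b + 1) N) (0\<^sub>m N (b + 1)) B"
    unfolding replicate_Suc append_Cons diag_block_mat.simps Let_def B_def[symmetric]
    by (simp only: S_def[symmetric] dB dS)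
  have N: "Suc q * (b + 1) + k = (b + 1) + N"
    by (simp add: N_def)
  show ?case
    unfolding eq N
  proof (intro conjI allI impI)
    show "four_block_mat S (0\<^sub>m (b + 1) N) (0\<^sub>m N (b + 1)) B \<in> carrier_mat (b + 1 + N) (b + 1 + N)"
      using dB dS by auto
  next
    fix i j
    assume ij: "i < b + 1 + N" "j < b + 1 + N"
    have ent: "four_block_mat S (0\<^sub>m (b + 1) N) (0\<^sub>m N (b + 1)) B $$ (i, j) =
      (if i < b + 1 then if j < b + 1 then S $$ (i, j) else (0\<^sub>m (b + 1) N) $$ (i, j - (b + 1))
       else if j < b + 1 then (0\<^sub>m N (b + 1)) $$ (i - (b + 1), j) else B $$ (i - (b + 1), j - (b + 1)))"
      using ij dB dS by (subst index_mat_four_block(1)) simp_all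
    show "four_block_mat S (0\<^sub>m (b + 1) N) (0\<^sub>m N (b + 1)) B $$ (i, j) =
      (if j = Suc i \<and> Suc i mod (b + 1) \<noteq> 0 then 1 else 0)"
    proof (cases "i < b + 1")
      case True
      then show ?thesis
        unfolding ent using ij by (cases "i = b") (auto simp: entS)
    next
      case False
      then have "Suc i = Suc (i - (b + 1)) + (b + 1)" by simp
      then have "Suc i mod (b + 1) = Suc (i - (b + 1)) mod (b + 1)"
        by (metis mod_add_self2)
      then show ?thesis
        unfolding ent using ij False by (auto simp: entB)
    qed
  qed
qed

lemma
  shows block_shift_mat_carrier: "block_shift_mat b n \<in> carrier_mat n n"
    and index_block_shift_mat: "i < n \<Longrightarrow> j < n \<Longrightarrow>
      block_shift_mat b n $$ (i, j) = (if j = Suc i \<and> Suc i mod (b + 1) \<noteq> 0 then 1 else 0)"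
proof -
  define k where "k = n - n div (b + 1) * (b + 1)"
  have "k = n mod (b + 1)"
    unfolding k_def by (rule minus_div_mult_eq_mod)
  then have "k \<le> b" and "n div (b + 1) * (b + 1) + k = n"
    using mod_less_divisor[of "b + 1" n] by (simp_all only: div_mult_mod_eq) auto
  note * = diag_block_shift_entries[OF this(1), of "n div (b + 1)", unfolded this(2)]
  show "block_shift_mat b n \<in> carrier_mat n n"
    using * by (simp only: block_shift_mat_def Let_def k_def[symmetric])
  show "i < n \<Longrightarrow> j < n \<Longrightarrow>
      block_shift_mat b n $$ (i, j) = (if j = Suc i \<and> Suc i mod (b + 1) \<noteq> 0 then 1 else 0)"
    using * by (simp only: block_shift_mat_def Let_def k_def[symmetric])
qed


section \<open>Eigenvalues of a perturbed block shift\<close>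

text \<open>
  The recursion is that of the moduli of the coordinates of an eigenvector. It is cut off at the
  multiples of \<open>m\<close>, so every index is at distance at most \<open>m\<close> from a cut. The induction is
  on that distance: one step turns a bound \<open>e L\<^sup>d\<close> into \<open>L / 2 (e + e L\<^sup>d)\<close>, and since
  \<open>e \<le> e L\<^sup>d\<close>, the spare factor \<open>1 / 2\<close> absorbs the inhomogeneous term. This avoids carrying
  a geometric sum.
\<close>
lemma back_substitution_bound:
  fixes w :: "nat \<Rightarrow> real" and e L :: real
  assumes "0 < m" "0 \<le> e" "2 \<le> L"
    and rec: "\<And>i. i < n \<Longrightarrow>
      w i \<le> L / 2 * (e + (if Suc i < n \<and> Suc i mod m \<noteq> 0 then w (Suc i) else 0))"
    and "i < n"
  shows "w i \<le> e * L ^ m"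
proof -
  have "\<forall>i < n. m - i mod m \<le> d \<longrightarrow> w i \<le> e * L ^ d" for d
  proof (induction d)
    case 0
    then show ?case
      using mod_less_divisor[OF \<open>0 < m\<close>] by (metis diff_is_0_eq le_zero_eq linorder_not_less)
  next
    case (Suc d)
    have L1: "1 \<le> L ^ d" using \<open>2 \<le> L\<close> by (intro one_le_power) simp
    show ?case
    proof (intro allI impI)
      fix i assume i: "i < n" "m - i mod m \<le> Suc d"
      have "(if Suc i < n \<and> Suc i mod m \<noteq> 0 then w (Suc i) else 0) \<le> e * L ^ d"
      proof (cases "Suc i < n \<and> Suc i mod m \<noteq> 0")
        case True
        then have "Suc i mod m = Suc (i mod m)" by (simp add: mod_Suc split: if_splits)
        then have "m - Suc i mod m \<le> d" using i by simp
        then show ?thesis using Suc.IH True by auto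
      next
        case False
        then have "(if Suc i < n \<and> Suc i mod m \<noteq> 0 then w (Suc i) else 0) = 0" by auto
        also have "0 \<le> e * L ^ d" using \<open>0 \<le> e\<close> L1 by simp
        finally show ?thesis .
      qed
      moreover have "e \<le> e * L ^ d"
        using mult_left_mono[OF L1 \<open>0 \<le> e\<close>] by simp
      ultimately have "w i \<le> L / 2 * (2 * (e * L ^ d))"
        using rec[OF i(1)] \<open>2 \<le> L\<close>
        by (smt (verit) mult_left_mono divide_nonneg_nonneg)
      then show "w i \<le> e * L ^ Suc d" by (simp add: algebra_simps)
    qed
  qed
  then show ?thesis using \<open>i < n\<close> by (meson diff_le_self)
qed

definition entry_sum :: "nat \<Rightarrow> complex mat \<Rightarrow> real" where
  "entry_sum n E = (\<Sum>i<n. \<Sum>j<n. cmod (E $$ (i, j)))"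

text \<open>
  Back substitution bounds every coordinate of an eigenvector by a multiple of the largest one.
  Applied to the largest coordinate itself, this makes the eigenvector cancel.
\<close>
lemma eigenvalue_block_shift_perturbation:
  fixes E :: "complex mat"
  assumes E: "E \<in> carrier_mat n n"
    and ev: "eigenvalue (block_shift_mat b n + E) l"
    and \<eta>: "0 < \<eta>" "\<eta> \<le> 1" "\<eta> \<le> cmod l"
  shows "1 \<le> entry_sum n E * (2 / \<eta>) ^ (b + 1)"
proof -
  let ?T = "block_shift_mat b n"
  note T = block_shift_mat_carrier[of b n]
  obtain x where x: "x \<in> carrier_vec n" "x \<noteq> 0\<^sub>v n" "(?T + E) *\<^sub>v x = l \<cdot>\<^sub>v x"
    using ev E T unfolding eigenvalue_def eigenvector_def by auto
  define v where "v = vec_index x"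
  define next_v where "next_v i = (if Suc i < n \<and> Suc i mod (b + 1) \<noteq> 0 then v (Suc i) else 0)" for i
  have row: "l * v i = next_v i + (\<Sum>j<n. E $$ (i, j) * v j)" if "i < n" for i
  proof -
    have "l * v i = vec_index ((?T + E) *\<^sub>v x) i"
      using x that by (simp add: v_def)
    also have "\<dots> = (\<Sum>j<n. (?T $$ (i, j) + E $$ (i, j)) * v j)"
      using x(1) E T that by (simp add: scalar_prod_def v_def atLeast0LessThan)
    also have "\<dots> = (\<Sum>j<n. ?T $$ (i, j) * v j) + (\<Sum>j<n. E $$ (i, j) * v j)"
      by (simp add: distrib_right sum.distrib)
    \<comment> \<open>The sum on the right picks out \<open>j = Suc i\<close>, and is empty if \<open>Suc i = n\<close>, which is why
      \<open>next_v\<close> also vanishes in the last row.\<close>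
    also have "(\<Sum>j<n. ?T $$ (i, j) * v j) =
        (\<Sum>j<n. if j = Suc i then (if Suc i mod (b + 1) \<noteq> 0 then v (Suc i) else 0) else 0)"
      using that by (intro sum.cong) (auto simp: index_block_shift_mat)
    also have "\<dots> = next_v i"
      by (simp add: next_v_def)
    finally show ?thesis .
  qed
  have "\<exists>i<n. v i \<noteq> 0"
    using x(1,2) unfolding v_def by (metis eq_vecI index_zero_vec carrier_vecD)
  then have "n > 0" by auto
  define m where "m = Max ((\<lambda>i. cmod (v i)) ` {..<n})"
  have m_ge: "cmod (v i) \<le> m" if "i < n" for i
    unfolding m_def using that by (intro Max_ge) auto
  have "m \<in> (\<lambda>i. cmod (v i)) ` {..<n}"
    unfolding m_def using \<open>n > 0\<close> by (intro Max_in) auto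
  then obtain i0 where i0: "i0 < n" "m = cmod (v i0)" by auto
  have "m > 0"
    using \<open>\<exists>i<n. v i \<noteq> 0\<close> m_ge by (metis less_le_trans zero_less_norm_iff)
  have E_bound: "cmod (\<Sum>j<n. E $$ (i, j) * v j) \<le> entry_sum n E * m" if "i < n" for i
  proof -
    have "cmod (\<Sum>j<n. E $$ (i, j) * v j) \<le> (\<Sum>j<n. cmod (E $$ (i, j)) * m)"
      by (intro sum_norm_le) (auto simp: norm_mult intro!: mult_left_mono m_ge)
    also have "\<dots> = (\<Sum>j<n. cmod (E $$ (i, j))) * m"
      by (simp add: sum_distrib_right)
    also have "\<dots> \<le> entry_sum n E * m"
      unfolding entry_sum_def using that \<open>m > 0\<close>
      by (intro mult_right_mono member_le_sum[where f = "\<lambda>i. \<Sum>j<n. cmod (E $$ (i, j))"])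
        (auto intro: sum_nonneg)
    finally show ?thesis .
  qed
  have "cmod (v i0) \<le> entry_sum n E * m * (2 / \<eta>) ^ (b + 1)"
  proof (rule back_substitution_bound[where w = "\<lambda>i. cmod (v i)" and n = n])
    show "0 \<le> entry_sum n E * m"
      using \<open>m > 0\<close> unfolding entry_sum_def by (intro mult_nonneg_nonneg sum_nonneg) auto
    show "2 \<le> 2 / \<eta>" using \<eta> by (simp add: field_simps)
    fix i assume i: "i < n"
    have "\<eta> * cmod (v i) \<le> cmod (l * v i)"
      using \<eta>(3) by (simp add: norm_mult mult_right_mono)
    also have "\<dots> \<le> cmod (next_v i) + entry_sum n E * m"
      unfolding row[OF i] by (intro norm_triangle_le add_left_mono E_bound[OF i])
    also have "cmod (next_v i) = (if Suc i < n \<and> Suc i mod (b + 1) \<noteq> 0 then cmod (v (Suc i)) else 0)"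
      by (simp add: next_v_def)
    finally show "cmod (v i) \<le> 2 / \<eta> / 2 * (entry_sum n E * m +
        (if Suc i < n \<and> Suc i mod (b + 1) \<noteq> 0 then cmod (v (Suc i)) else 0))"
      using \<eta>(1) by (simp add: field_simps)
  qed (use i0 in auto)
  then have "m * 1 \<le> m * (entry_sum n E * (2 / \<eta>) ^ (b + 1))"
    by (simp add: i0(2)[symmetric] mult_ac)
  then show ?thesis using \<open>m > 0\<close> by (simp only: mult_le_cancel_left_pos)
qed


section \<open>Integrals against the empirical spectral distribution\<close>

text \<open>
  The empirical spectral distribution is a uniform distribution on a nonempty finite multiset of
  eigenvalues, so integration against it is averaging. That the multiset is nonempty is the
  fundamental theorem of algebra.
\<close>
lemma dist_integral_esd_le:
  fixes g :: "complex \<Rightarrow> complex"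
  assumes A: "A \<in> carrier_mat n n" and n: "n > 0" and g: "continuous_on UNIV g"
    and close: "\<And>l. eigenvalue A l \<Longrightarrow> dist (g l) c \<le> \<epsilon>"
  shows "dist (\<integral>z. g z \<partial>esd A) c \<le> \<epsilon>"
proof -
  define p where "p = pmf_of_multiset (proots (char_poly A))"
  have deg: "degree (char_poly A) = n"
    using degree_monic_char_poly[OF A] by simp
  then have "char_poly A \<noteq> 0" using n by auto
  moreover have "proots (char_poly A) \<noteq> {#}"
    using size_proots_complex[of "char_poly A"] deg n by auto
  ultimately have set_p: "set_pmf p = {l. eigenvalue A l}" and fin: "finite (set_pmf p)"
    unfolding p_def by (simp_all add: eigenvalue_root_char_poly[OF A] poly_roots_finite)
  have int: "integrable p f" for f :: "complex \<Rightarrow> 'b :: {banach, second_countable_topology}"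
    by (rule integrable_measure_pmf_finite[OF fin])
  have "(\<integral>z. g z \<partial>esd A) = (\<integral>z. g z \<partial>p)"
    unfolding esd_def p_def[symmetric]
    by (subst integral_distr) (auto intro: borel_measurable_continuous_onI g)
  then have "dist (\<integral>z. g z \<partial>esd A) c = norm (\<integral>z. g z - c \<partial>p)"
    by (simp add: dist_norm int)
  also have "\<dots> \<le> (\<integral>z. norm (g z - c) \<partial>p)"
    by (rule integral_norm_bound)
  also have "\<dots> \<le> \<epsilon>"
    by (rule measure_pmf.integral_le_const[OF int])
      (auto intro!: AE_pmfI simp: set_p dist_norm[symmetric] close)
  finally show ?thesis .
qed


section \<open>The size of the random perturbation\<close>

lemma (in prob_space) expectation_norm_le_L2:
  fixes X :: "'a \<Rightarrow> 'b :: {banach, second_countable_topology}"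
  assumes "integrable M X" "integrable M (\<lambda>\<omega>. (norm (X \<omega>))\<^sup>2)"
  shows "expectation (\<lambda>\<omega>. norm (X \<omega>)) \<le> sqrt (expectation (\<lambda>\<omega>. (norm (X \<omega>))\<^sup>2))"
proof (rule real_le_rsqrt)
  have "0 \<le> variance (\<lambda>\<omega>. norm (X \<omega>))" by (rule variance_positive)
  also have "\<dots> = expectation (\<lambda>\<omega>. (norm (X \<omega>))\<^sup>2) - (expectation (\<lambda>\<omega>. norm (X \<omega>)))\<^sup>2"
    using assms by (intro variance_eq integrable_norm)
  finally show "(expectation (\<lambda>\<omega>. norm (X \<omega>)))\<^sup>2 \<le> expectation (\<lambda>\<omega>. (norm (X \<omega>))\<^sup>2)" by simp
qed

text \<open>Markov's inequality. The measurability claim allows the event to serve as a measurable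
  superset of events about eigenvalues, whose own measurability would be laborious to establish.\<close>
lemma prob_entry_sum_ge:
  assumes M: "prob_space M" and n: "n > 0" and \<Phi>: "iid_random_mat M n v \<Phi>" and "t > 0"
  shows "{\<omega> \<in> space M. t \<le> entry_sum n (\<Phi> \<omega>)} \<in> sets M"
    and "measure M {\<omega> \<in> space M. t \<le> entry_sum n (\<Phi> \<omega>)} \<le> (real n)\<^sup>2 * sqrt v / t"
proof -
  interpret prob_space M by (rule M)
  have I: "integrable M (\<lambda>\<omega>. \<Phi> \<omega> $$ (i, j))"
    and V: "integrable M (\<lambda>\<omega>. (cmod (\<Phi> \<omega> $$ (i, j)))\<^sup>2)" "expectation (\<lambda>\<omega>. (cmod (\<Phi> \<omega> $$ (i, j)))\<^sup>2) = v"
    if "i < n" "j < n" for i j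
    using \<Phi> that unfolding iid_random_mat_def by blast+
  have int: "integrable M (\<lambda>\<omega>. entry_sum n (\<Phi> \<omega>))"
    unfolding entry_sum_def
    by (intro Bochner_Integration.integrable_sum integrable_norm I) auto
  then show "{\<omega> \<in> space M. t \<le> entry_sum n (\<Phi> \<omega>)} \<in> sets M"
    by measurable
  have "expectation (\<lambda>\<omega>. entry_sum n (\<Phi> \<omega>)) = (\<Sum>i<n. \<Sum>j<n. expectation (\<lambda>\<omega>. cmod (\<Phi> \<omega> $$ (i, j))))"
    unfolding entry_sum_def
    by (subst Bochner_Integration.integral_sum;
        (intro sum.cong Bochner_Integration.integral_sum Bochner_Integration.integrable_sum integrable_norm I)?) auto
  also have "\<dots> \<le> (\<Sum>i<n. \<Sum>j<n. sqrt v)"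
    using expectation_norm_le_L2[OF I V(1)] V(2) by (intro sum_mono) force
  finally have "expectation (\<lambda>\<omega>. entry_sum n (\<Phi> \<omega>)) \<le> (real n)\<^sup>2 * sqrt v"
    by (simp add: power2_eq_square mult.assoc)
  moreover have "measure M {\<omega> \<in> space M. t \<le> entry_sum n (\<Phi> \<omega>)}
      \<le> expectation (\<lambda>\<omega>. entry_sum n (\<Phi> \<omega>)) / t"
    by (rule integral_Markov_inequality_measure[OF int sets.empty_sets])
      (use \<open>t > 0\<close> in \<open>auto simp: entry_sum_def intro!: sum_nonneg\<close>)
  ultimately show "measure M {\<omega> \<in> space M. t \<le> entry_sum n (\<Phi> \<omega>)} \<le> (real n)\<^sup>2 * sqrt v / t"
    using \<open>t > 0\<close> by (meson divide_right_mono less_imp_le order_trans)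
qed

lemma entry_sum_smult:
  "E \<in> carrier_mat n n \<Longrightarrow> entry_sum n (c \<cdot>\<^sub>m E) = cmod c * entry_sum n E"
  by (auto simp: entry_sum_def sum_distrib_left norm_mult intro!: sum.cong)

text \<open>
  Since \<open>b\<close> is \<open>o(log n)\<close>, the power \<open>L\<^sup>b\<close> is eventually at most \<open>n\<close> to the power \<open>\<delta> / 2\<close>,
  for every fixed \<open>L\<close>; the constant \<open>\<delta> / (2 ln L)\<close> in the proof is chosen for this.
\<close>
lemma powr_mult_power_tendsto_0:
  fixes b :: "nat \<Rightarrow> nat" and L \<delta> :: real
  assumes b: "(\<lambda>n. real (b n)) \<in> o(\<lambda>n. ln (real n))" and "\<delta> > 0" "L > 1"
  shows "(\<lambda>n. real n powr (-\<delta>) * L ^ (b n + 1)) \<longlonglongrightarrow> 0"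
proof (rule Lim_null_comparison)
  have lnL: "ln L > 0" using \<open>L > 1\<close> by simp
  have "\<forall>\<^sub>F n in sequentially. norm (real (b n)) \<le> \<delta> / (2 * ln L) * norm (ln (real n))"
    using b lnL \<open>\<delta> > 0\<close> by (intro landau_o.smallD) auto
  then show "\<forall>\<^sub>F n in sequentially. norm (real n powr (-\<delta>) * L ^ (b n + 1)) \<le> L * real n powr (-(\<delta> / 2))"
    using eventually_gt_at_top[of 0]
  proof eventually_elim
    case (elim n)
    then have "real (b n) * ln L \<le> \<delta> / 2 * ln (real n)"
      using lnL by (simp add: field_simps)
    have "L ^ b n = exp (real (b n) * ln L)"
      using \<open>L > 1\<close> by (simp add: exp_of_nat_mult)
    also have "\<dots> \<le> exp (\<delta> / 2 * ln (real n))" using \<open>real (b n) * ln L \<le> _\<close> by simp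
    also have "\<dots> = real n powr (\<delta> / 2)" using elim by (simp add: powr_def)
    finally have "real n powr (-\<delta>) * L ^ b n \<le> real n powr (-\<delta>) * real n powr (\<delta> / 2)"
      by (intro mult_left_mono) auto
    also have "\<dots> = real n powr (-(\<delta> / 2))" by (simp add: powr_add[symmetric])
    finally show ?case
      using \<open>L > 1\<close> by (simp add: mult_left_mono mult.left_commute)
  qed
  show "(\<lambda>n. L * real n powr (-(\<delta> / 2))) \<longlonglongrightarrow> 0"
    using \<open>\<delta> > 0\<close> by (intro tendsto_mult_right_zero tendsto_neg_powr filterlim_real_sequentially) auto
qed


section \<open>Convergence of the empirical spectral distribution\<close>

text \<open>
  The quantitative, fixed-\<open>n\<close> form of the convergence. The exponent \<open>3 / 2 - \<gamma>\<close> is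
  \<open>2 - 1 / 2 - \<gamma>\<close>: number of entries, size of an entry of \<open>\<Phi>\<close>, scaling of the perturbation.
\<close>
lemma prob_dist_esd_block_shift_le:
  fixes g :: "complex \<Rightarrow> complex" and \<Phi> :: "'w \<Rightarrow> complex mat"
  assumes M: "prob_space M" and n: "n > 0" and \<Phi>: "iid_random_mat M n (1 / real n) \<Phi>"
    and g: "continuous_on UNIV g" and \<eta>: "0 < \<eta>" "\<eta> \<le> 1"
    and close: "\<And>z. cmod z < \<eta> \<Longrightarrow> dist (g z) c \<le> \<epsilon>"
  shows "measure M {\<omega> \<in> space M. dist (\<integral>z. g z \<partial>esd (block_shift_mat b n
            + complex_of_real (real n powr (- \<gamma>)) \<cdot>\<^sub>m \<Phi> \<omega>)) c > \<epsilon>}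
         \<le> real n powr (-(\<gamma> - 3 / 2)) * (2 / \<eta>) ^ (b + 1)" (is "measure M ?bad \<le> _")
proof -
  interpret prob_space M by (rule M)
  \<comment> \<open>The largest entry sum of \<open>\<Phi>\<close> for which the scaled matrix still stays below the deterministic
    threshold for an eigenvalue of modulus \<open>\<eta>\<close>.\<close>
  define t where "t = 1 / (real n powr (- \<gamma>) * (2 / \<eta>) ^ (b + 1))"
  have t: "t > 0" using n \<eta> by (simp add: t_def)
  have sub: "?bad \<subseteq> {\<omega> \<in> space M. t \<le> entry_sum n (\<Phi> \<omega>)}"
  proof (clarsimp, rule ccontr)
    fix \<omega>
    let ?E = "complex_of_real (real n powr (- \<gamma>)) \<cdot>\<^sub>m \<Phi> \<omega>"
    assume \<omega>: "\<omega> \<in> space M" and bad: "\<epsilon> < dist (\<integral>z. g z \<partial>esd (block_shift_mat b n + ?E)) c"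
      and small: "\<not> t \<le> entry_sum n (\<Phi> \<omega>)"
    have carr: "\<Phi> \<omega> \<in> carrier_mat n n"
      using \<Phi> \<omega> unfolding iid_random_mat_def by blast
    have "entry_sum n ?E * (2 / \<eta>) ^ (b + 1) < 1"
      using small n \<eta> by (simp add: t_def entry_sum_smult[OF carr] field_simps)
    then have "cmod l < \<eta>" if "eigenvalue (block_shift_mat b n + ?E) l" for l
      using eigenvalue_block_shift_perturbation[OF _ that, of \<eta>] carr \<eta> by force
    then have "dist (\<integral>z. g z \<partial>esd (block_shift_mat b n + ?E)) c \<le> \<epsilon>"
      using carr block_shift_mat_carrier[of b n]
      by (intro dist_integral_esd_le[OF _ n g] close) auto
    with bad show False by simp
  qed
  have "measure M ?bad \<le> measure M {\<omega> \<in> space M. t \<le> entry_sum n (\<Phi> \<omega>)}"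
    by (rule finite_measure_mono[OF sub prob_entry_sum_ge(1)[OF M n \<Phi> t]])
  also have "\<dots> \<le> (real n)\<^sup>2 * sqrt (1 / real n) / t"
    by (rule prob_entry_sum_ge(2)[OF M n \<Phi> t])
  also have "\<dots> = (real n)\<^sup>2 * sqrt (1 / real n) * real n powr (- \<gamma>) * (2 / \<eta>) ^ (b + 1)"
    by (simp add: t_def)
  also have "(real n)\<^sup>2 * sqrt (1 / real n) * real n powr (- \<gamma>) = real n powr (2 + (- (1 / 2)) + (- \<gamma>))"
    using n by (simp only: powr_add) (simp add: powr_half_sqrt powr_minus real_sqrt_divide divide_simps)
  finally show ?thesis by simp
qed

theorem theorem3:
  fixes M :: "nat \<Rightarrow> 'w measure"
    and \<Phi> :: "nat \<Rightarrow> 'w \<Rightarrow> complex mat"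
    and b :: "nat \<Rightarrow> nat"
    and \<gamma> :: real
  assumes "\<And>n. n > 0 \<Longrightarrow> b n > 0"
    and "(\<lambda>n. real (b n)) \<in> o(\<lambda>n. ln (real n))"
    and "\<gamma> > 3 / 2"
    and "\<And>n. n > 0 \<Longrightarrow> prob_space (M n)"
    and "\<And>n. n > 0 \<Longrightarrow> iid_random_mat (M n) n (1 / real n) (\<Phi> n)"
  shows "measures_tendsto_in_prob M
           (\<lambda>n \<omega>. esd (block_shift_mat (b n) n
                        + complex_of_real (real n powr (- \<gamma>)) \<cdot>\<^sub>m \<Phi> n \<omega>))
           (return borel 0)"
  unfolding measures_tendsto_in_prob_def tendsto_in_prob_def
proof (intro allI impI)
  fix g :: "complex \<Rightarrow> complex" and \<epsilon> :: real
  assume "smooth g \<and> compactly_supported g" and "\<epsilon> > 0"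
  then have "k_times_cont_diff 0 g"
    unfolding smooth_def by blast
  then have g: "continuous_on UNIV g"
    by simp
  then obtain d where d: "d > 0" "\<And>z. dist z 0 < d \<Longrightarrow> dist (g z) (g 0) < \<epsilon>"
    using \<open>\<epsilon> > 0\<close> unfolding continuous_on_iff by (metis UNIV_I)
  \<comment> \<open>The cap keeps \<open>2 / \<eta> \<ge> 2\<close>, which back substitution requires.\<close>
  define \<eta> where "\<eta> = min d 1"
  have \<eta>: "0 < \<eta>" "\<eta> \<le> 1" and close: "\<And>z. cmod z < \<eta> \<Longrightarrow> dist (g z) (g 0) \<le> \<epsilon>"
    using d by (auto simp: \<eta>_def intro: less_imp_le)
  have lim: "(\<integral>z. g z \<partial>return borel 0) = g 0"
    using g by (intro integral_return) (auto intro: borel_measurable_continuous_onI)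
  have "2 / \<eta> > 1" using \<eta> by simp
  show "(\<lambda>n. measure (M n) {\<omega> \<in> space (M n).
      dist (\<integral>z. g z \<partial>esd (block_shift_mat (b n) n + complex_of_real (real n powr (- \<gamma>)) \<cdot>\<^sub>m \<Phi> n \<omega>))
        (\<integral>z. g z \<partial>return borel 0) > \<epsilon>}) \<longlonglongrightarrow> 0"
    unfolding lim
  proof (rule Lim_null_comparison)
    show "(\<lambda>n. real n powr (-(\<gamma> - 3 / 2)) * (2 / \<eta>) ^ (b n + 1)) \<longlonglongrightarrow> 0"
      using assms(2,3) \<open>2 / \<eta> > 1\<close> by (intro powr_mult_power_tendsto_0) auto
    show "\<forall>\<^sub>F n in sequentially. norm (measure (M n) {\<omega> \<in> space (M n).
      dist (\<integral>z. g z \<partial>esd (block_shift_mat (b n) n + complex_of_real (real n powr (- \<gamma>)) \<cdot>\<^sub>m \<Phi> n \<omega>))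
        (g 0) > \<epsilon>}) \<le> real n powr (-(\<gamma> - 3 / 2)) * (2 / \<eta>) ^ (b n + 1)"
      using eventually_gt_at_top[of 0]
    proof eventually_elim
      case (elim n)
      show ?case
        using prob_dist_esd_block_shift_le[OF assms(4)[OF elim] elim assms(5)[OF elim] g \<eta> close] by simp
    qed
  qed
qed

end
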